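(* Let $f:\mathbb{N}_0\to\mathbb{N}_0$ be periodic, i.e. there is an integer $p\ge 1$ with $f(n+p)=f(n)$ for all $n\in\mathbb{N}_0$. Then the $f$-sequence $\{a_n\}_{n=0}^\infty$ associated with $f$ satisfies a linear recurrence relation: there exist an integer $k\ge 1$ and real constants $c_1,\dots,c_k$ such that $a_n=\sum_{i=1}^k c_i a_{n-i}$ for all $n\ge k$.
   Context: $\mathbb{N}_0=\{0,1,2,\dots\}$, and natural numbers are positive integers. Given $f:\mathbb{N}_0\to\mathbb{N}_0$ and a sequence $\{a_n\}_{n=0}^\infty$, an $f$-decomposition of $x$ using $\{a_n\}$ is a finite sum $x=\sum_{i} a_{n_i}$ of terms of the sequence with pairwise distinct indices $n_i\ge 0$, such that for every $a_{n_i}$ in the sum, the previous $f(n_i)$ terms $a_{n_i-f(n_i)},\dots,a_{n_i-1}$ (those among them with index $\ge 0$) are not in the sum. The $f$-sequence associated with $f$ is the unique increasing sequence of natural numbers $\{a_n\}_{n=0}^\infty$ such that every positive integer has a unique $f$-decomposition using it; explicitly, it is given by $a_n=1$ for $n<1$ and $a_n=a_{n-1}+a_{n-1-f(n-1)}$ for $n\ge1$. *)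

theory Defs
  imports Complex_Main
begin

text \<open>A decomposition is represented by its set of indices.  The bound \<open>j \<le> n\<close> restricts the
  previous \<open>f n\<close> terms to those with a nonnegative index.\<close>

definition f_decomposition :: "(nat \<Rightarrow> nat) \<Rightarrow> (nat \<Rightarrow> nat) \<Rightarrow> nat \<Rightarrow> nat set \<Rightarrow> bool" where
  "f_decomposition f a x S \<longleftrightarrow>
     finite S \<and> x = (\<Sum>n\<in>S. a n) \<and> (\<forall>n\<in>S. \<forall>j. 1 \<le> j \<and> j \<le> f n \<and> j \<le> n \<longrightarrow> n - j \<notin> S)"

definition is_f_sequence :: "(nat \<Rightarrow> nat) \<Rightarrow> (nat \<Rightarrow> nat) \<Rightarrow> bool" where
  "is_f_sequence f a \<longleftrightarrow>
     strict_mono a \<and> (\<forall>n. a n \<ge> 1) \<and> (\<forall>x\<ge>1. \<exists>!S. f_decomposition f a x S)"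

definition f_sequence :: "(nat \<Rightarrow> nat) \<Rightarrow> nat \<Rightarrow> nat" where
  "f_sequence f = (THE a. is_f_sequence f a)"

text \<open>The description is well-defined: there is exactly one such sequence, namely the one given by
  the explicit recursion.  Truncated subtraction implements the convention that terms with negative
  index equal \<open>1\<close>, since the term with index \<open>0\<close> is \<open>1\<close>.\<close>

fun f_recursion :: "(nat \<Rightarrow> nat) \<Rightarrow> nat \<Rightarrow> nat" where
  "f_recursion f 0 = 1"
| "f_recursion f (Suc n) = f_recursion f n + f_recursion f (n - f n)"

definition f_legal :: "(nat \<Rightarrow> nat) \<Rightarrow> nat set \<Rightarrow> bool" where
  "f_legal f S \<longleftrightarrow> (\<forall>n\<in>S. \<forall>m\<in>S. m < n \<longrightarrow> m + f n < n)"

lemma f_decomposition_iff: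
  "f_decomposition f a x S \<longleftrightarrow> finite S \<and> x = sum a S \<and> f_legal f S"
proof -
  have "(\<forall>j. 1 \<le> j \<and> j \<le> f n \<and> j \<le> n \<longrightarrow> n - j \<notin> S) \<longleftrightarrow> (\<forall>m\<in>S. m < n \<longrightarrow> m + f n < n)" for n
  proof (intro iffI allI impI ballI)
    fix m
    assume "\<forall>j. 1 \<le> j \<and> j \<le> f n \<and> j \<le> n \<longrightarrow> n - j \<notin> S" "m \<in> S" "m < n"
    then show "m + f n < n"
      by (drule_tac x = "n - m" in spec) (auto simp: not_less)
  next
    fix j
    assume "\<forall>m\<in>S. m < n \<longrightarrow> m + f n < n" "1 \<le> j \<and> j \<le> f n \<and> j \<le> n"
    then show "n - j \<notin> S"
      by (auto dest!: bspec[of S _ "n - j"])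
  qed
  then show ?thesis
    unfolding f_decomposition_def f_legal_def by simp
qed

lemma f_recursion_pos: "f_recursion f n \<ge> 1"
  by (induction f n rule: f_recursion.induct) auto

lemma f_recursion_strict_mono: "strict_mono (f_recursion f)"
  unfolding strict_mono_Suc_iff
  using f_recursion_pos by (metis f_recursion.simps(2) less_add_same_cancel1 less_eq_Suc_le One_nat_def)

lemma f_legal_step:
  "{S. f_legal f S \<and> S \<subseteq> {..<Suc n}} =
   {S. f_legal f S \<and> S \<subseteq> {..<n}} \<union> insert n ` {S. f_legal f S \<and> S \<subseteq> {..<n - f n}}"
  (is "?L = ?A \<union> ?B")
proof (intro equalityI subsetI)
  fix S assume S: "S \<in> ?L"
  show "S \<in> ?A \<union> ?B"
  proof (cases "n \<in> S")
    case False
    then have "S \<subseteq> {..<n}" using S by (auto simp: less_Suc_eq)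
    then show ?thesis using S by auto
  next
    case True
    have "m < n - f n" if "m \<in> S - {n}" for m
    proof -
      have "m < n" using S that by (auto simp: less_Suc_eq)
      then have "m + f n < n" using S that True by (auto simp: f_legal_def)
      then show ?thesis by simp
    qed
    then have "S - {n} \<subseteq> {..<n - f n}" by auto
    moreover have "f_legal f (S - {n})" using S by (auto simp: f_legal_def)
    moreover have "S = insert n (S - {n})" using True by auto
    ultimately show ?thesis by blast
  qed
next
  fix S assume "S \<in> ?A \<union> ?B"
  then show "S \<in> ?L"
  proof
    assume "S \<in> ?A" then show ?thesis by (auto simp: less_Suc_eq)
  next
    assume "S \<in> ?B"
    then obtain T where T: "S = insert n T" "f_legal f T" "T \<subseteq> {..<n - f n}" by auto
    then have "m + f n < n" if "m \<in> T" for m using that by (auto simp: subset_eq)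
    moreover from this have "m < n" if "m \<in> T" for m using that by fastforce
    ultimately show ?thesis using T unfolding f_legal_def by (auto simp: less_Suc_eq)
  qed
qed

lemma f_recursion_bij:
  "bij_betw (sum (f_recursion f)) {S. f_legal f S \<and> S \<subseteq> {..<n}} {..<f_recursion f n}"
proof (induction n rule: less_induct)
  case (less n)
  let ?a = "f_recursion f"
  show ?case
  proof (cases n)
    case 0
    then have "{S. f_legal f S \<and> S \<subseteq> {..<n}} = {{}}" by (auto simp: f_legal_def)
    then show ?thesis using 0 by (auto simp: bij_betw_def)
  next
    case (Suc k)
    let ?B = "{S. f_legal f S \<and> S \<subseteq> {..<k - f k}}"
    have 1: "bij_betw (sum ?a) {S. f_legal f S \<and> S \<subseteq> {..<k}} {..<?a k}"
      using less Suc by simp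
    have 2: "bij_betw (sum ?a) ?B {..<?a (k - f k)}"
      using less Suc by simp
    have nin: "k \<notin> S" if "S \<in> ?B" for S using that by auto
    have ins: "sum ?a (insert k S) = ?a k + sum ?a S" if "S \<in> ?B" for S
    proof -
      have "finite S" using that finite_subset by blast
      then show ?thesis using nin[OF that] by simp
    qed
    have "inj_on (sum ?a) (insert k ` ?B)"
    proof (rule inj_onI)
      fix X Y assume "X \<in> insert k ` ?B" "Y \<in> insert k ` ?B" and eq: "sum ?a X = sum ?a Y"
      then obtain S T where ST: "X = insert k S" "Y = insert k T" "S \<in> ?B" "T \<in> ?B" by blast
      then have "sum ?a S = sum ?a T" using eq ins by simp
      then show "X = Y" using 2 ST unfolding bij_betw_def inj_on_def by blast
    qed
    moreover have "sum ?a ` insert k ` ?B = {?a k..<?a k + ?a (k - f k)}"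
    proof -
      have "sum ?a ` insert k ` ?B = (+) (?a k) ` sum ?a ` ?B"
        unfolding image_image using ins by (intro image_cong) auto
      also have "\<dots> = (+) (?a k) ` {0..<?a (k - f k)}"
        using 2 by (simp add: bij_betw_def lessThan_atLeast0)
      finally show ?thesis by (simp add: image_add_atLeastLessThan add.commute)
    qed
    ultimately have 3: "bij_betw (sum ?a) (insert k ` ?B) {?a k..<?a k + ?a (k - f k)}"
      by (simp add: bij_betw_def)
    have "{..<?a k} \<union> {?a k..<?a k + ?a (k - f k)} = {..<?a n}"
      using Suc by auto
    moreover have "{..<?a k} \<inter> {?a k..<?a k + ?a (k - f k)} = {}"
      by auto
    ultimately show ?thesis
      using bij_betw_combine[OF 1 3] f_legal_step[of f k] unfolding Suc by presburger
  qed
qed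

lemma is_f_sequence_f_recursion: "is_f_sequence f (f_recursion f)"
  unfolding is_f_sequence_def f_decomposition_iff
proof (intro conjI allI impI f_recursion_strict_mono f_recursion_pos)
  let ?a = "f_recursion f"
  fix x :: nat
  have "x < ?a (Suc x)"
    using strict_mono_imp_increasing[OF f_recursion_strict_mono[of f], of "Suc x"] by simp
  then have "x \<in> sum ?a ` {S. f_legal f S \<and> S \<subseteq> {..<Suc x}}"
    using f_recursion_bij[of f "Suc x"] unfolding bij_betw_def by blast
  then obtain S where S: "x = sum ?a S" "f_legal f S" "S \<subseteq> {..<Suc x}" by blast
  show "\<exists>!S. finite S \<and> x = sum ?a S \<and> f_legal f S"
  proof (rule ex1I[of _ S])
    show "finite S \<and> x = sum ?a S \<and> f_legal f S" using S finite_subset by blast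
  next
    fix T assume T: "finite T \<and> x = sum ?a T \<and> f_legal f T"
    have "finite (S \<union> T)" using T S finite_subset by blast
    then obtain N where N: "S \<union> T \<subseteq> {..<N}" unfolding finite_nat_set_iff_bounded by blast
    then show "T = S"
      using f_recursion_bij[of f N] S T unfolding bij_betw_def inj_on_def by auto
  qed
qed

lemma is_f_sequence_unique:
  assumes "is_f_sequence f b"
  shows "b = f_recursion f"
proof
  fix n
  let ?a = "f_recursion f"
  have mono: "strict_mono b" and pos: "\<And>n. b n \<ge> 1"
    and ex1: "\<And>x. x \<ge> 1 \<Longrightarrow> \<exists>!S. finite S \<and> x = sum b S \<and> f_legal f S"
    using assms unfolding is_f_sequence_def f_decomposition_iff by auto
  show "b n = ?a n"
  proof (induction n rule: less_induct)
    case (less n)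
    have sums: "sum b S = sum ?a S" if "S \<subseteq> {..<n}" for S
      using that less by (intro sum.cong) auto
    have rng: "sum ?a ` {S. f_legal f S \<and> S \<subseteq> {..<n}} = {..<?a n}"
      using f_recursion_bij[of f n] by (simp add: bij_betw_def)
    have "b n \<ge> ?a n"
    proof (rule ccontr)
      assume "\<not> b n \<ge> ?a n"
      then have "b n \<in> sum ?a ` {S. f_legal f S \<and> S \<subseteq> {..<n}}" using rng by simp
      then obtain S where S: "b n = sum b S" "f_legal f S" "S \<subseteq> {..<n}"
        using sums by auto
      have "finite S" using S finite_subset by blast
      moreover have "f_legal f {n}" by (simp add: f_legal_def)
      ultimately have "S = {n}" using ex1[OF pos[of n]] S by (metis finite.emptyI finite_insert sum.empty sum.insert empty_iff add_0_right)
      then show False using S by auto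
    qed
    moreover have "b n \<le> ?a n"
    proof -
      obtain S where S: "finite S" "?a n = sum b S" "f_legal f S"
        using ex1[OF f_recursion_pos[of f n]] by blast
      have "\<not> S \<subseteq> {..<n}"
      proof
        assume "S \<subseteq> {..<n}"
        then have "sum ?a S \<in> {..<?a n}" using rng S by blast
        then show False using sums[OF \<open>S \<subseteq> {..<n}\<close>] S by simp
      qed
      then obtain m where "m \<in> S" "n \<le> m" by (meson lessThan_iff not_less subsetI)
      then have "b n \<le> b m" using mono by (simp add: strict_mono_less_eq)
      also have "b m \<le> sum b S" using S \<open>m \<in> S\<close> by (intro member_le_sum) auto
      finally show ?thesis using S by simp
    qed
    ultimately show ?case by simp
  qed
qed

lemma f_sequence_eq: "f_sequence f = f_recursion f"
  unfolding f_sequence_def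
  using is_f_sequence_f_recursion is_f_sequence_unique by (rule the_equality)

end

theory Submission
  imports Defs
begin

text \<open>Let \<open>p\<close> be a period of \<open>f\<close> and \<open>M\<close> an upper bound for its values.  The
  \<open>f\<close>-sequence \<open>a\<close> satisfies
  \<open>b (Suc n) = b n + b (n - f n)\<close> for \<open>n \<ge> M\<close>.  This is a linear equation in \<open>b\<close>, whose coefficients
  depend on \<open>n\<close>, but only with period \<open>p\<close>: hence all the translates \<open>n \<mapsto> a (n + k)\<close> with \<open>p dvd k\<close>
  satisfy it as well.  A solution is determined by its values at \<open>0, \<dots>, M\<close>
  (\<open>solution_vanishes_if_initially_zero\<close>), so the solutions form a space of dimension at most
  \<open>M + 1\<close>, and any \<open>M + 2\<close> of these translates are linearly dependent
  (\<open>nontrivial_homogeneous_solution\<close>).  A linear dependence between translates of \<open>a\<close> is a linear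
  recurrence with constant coefficients: solve it for the translate of largest shift
  (\<open>linear_recurrence_of_dependent_translates\<close>).\<close>

text \<open>Gaussian elimination: an equation in which some unknown \<open>q\<close> has a nonzero coefficient is used to
  eliminate \<open>q\<close> from the others, which lowers both the number of equations and that of unknowns
  by one.  An equation without such an unknown can be dropped.\<close>

lemma nontrivial_homogeneous_solution:
  fixes v :: "'k \<Rightarrow> 'j \<Rightarrow> 'a::field"
  assumes "finite J" "finite K" "card J < card K"
  shows "\<exists>c. (\<exists>k\<in>K. c k \<noteq> 0) \<and> (\<forall>j\<in>J. (\<Sum>k\<in>K. c k * v k j) = 0)"
  using assms
proof (induction J arbitrary: K v rule: finite_induct)
  case empty
  then have "K \<noteq> {}" by auto
  then show ?case by (intro exI[of _ "\<lambda>_. 1"]) auto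
next
  case (insert j J)
  show ?case
  proof (cases "\<forall>k\<in>K. v k j = 0")
    case True
    obtain c where "\<exists>k\<in>K. c k \<noteq> 0" "\<forall>i\<in>J. (\<Sum>k\<in>K. c k * v k i) = 0"
      using insert.IH[of K v] insert.prems insert.hyps by auto
    with True show ?thesis by (intro exI[of _ c]) auto
  next
    case False
    then obtain q where q: "q \<in> K" "v q j \<noteq> 0" by blast
    define w where "w k i = v k i - v k j / v q j * v q i" for k i
    have "card J < card (K - {q})"
      using insert.prems insert.hyps q by simp
    then obtain c where c: "\<exists>k\<in>K - {q}. c k \<noteq> 0"
      "\<And>i. i \<in> J \<Longrightarrow> (\<Sum>k\<in>K - {q}. c k * w k i) = 0"
      using insert.IH[of "K - {q}" w] insert.prems by auto
    \<comment> \<open>The value that equation \<open>j\<close> forces on the eliminated unknown.\<close>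
    define t where "t = - (\<Sum>k\<in>K - {q}. c k * v k j) / v q j"
    define d where "d = c(q := t)"
    have split: "(\<Sum>k\<in>K. d k * v k i) = t * v q i + (\<Sum>k\<in>K - {q}. c k * v k i)" for i
      using q insert.prems by (simp add: sum.remove[of K q] d_def)
    have reduced: "(\<Sum>k\<in>K. d k * v k i) = (\<Sum>k\<in>K - {q}. c k * w k i)" for i
      unfolding split t_def w_def
      by (simp add: algebra_simps sum_subtractf sum_distrib_left sum_divide_distrib)
    have "(\<Sum>k\<in>K. d k * v k j) = 0"
      unfolding split t_def using q by simp
    moreover have "\<exists>k\<in>K. d k \<noteq> 0" using c(1) by (auto simp: d_def)
    ultimately show ?thesis
      using c(2) reduced by (intro exI[of _ d]) auto
  qed
qed

text \<open>The dependence is divided by its last nonzero coefficient, at the shift \<open>N\<close> say.  The order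
  \<open>N\<close> of the resulting recurrence is positive because \<open>a 0 \<noteq> 0\<close>: for \<open>N = 0\<close> the dependence
  would say that \<open>a\<close> vanishes.\<close>

lemma linear_recurrence_of_dependent_translates:
  fixes a :: "nat \<Rightarrow> 'a::field"
  assumes K: "finite K"
    and dependent: "\<And>n. (\<Sum>k\<in>K. c k * a (n + k)) = 0"
    and nontrivial: "\<exists>k\<in>K. c k \<noteq> 0"
    and "a 0 \<noteq> 0"
  shows "\<exists>N\<ge>1. \<exists>d. \<forall>n\<ge>N. a n = (\<Sum>i = 1..N. d i * a (n - i))"
proof -
  define g where "g k = (if k \<in> K then c k else 0)" for k
  define N where "N = Max {k\<in>K. c k \<noteq> 0}"
  have N: "N \<in> K" "c N \<noteq> 0"
    using Max_in[of "{k\<in>K. c k \<noteq> 0}"] K nontrivial unfolding N_def by auto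
  have "k \<le> N" if "k \<in> K" "c k \<noteq> 0" for k
    using that K unfolding N_def by (intro Max_ge) auto
  then have "(\<Sum>k\<in>K. c k * a (n + k)) = (\<Sum>k\<le>N. g k * a (n + k))" for n
    using K by (intro sum.mono_neutral_cong) (auto simp: g_def)
  then have "(\<Sum>k\<le>N. g k * a (n + k)) = 0" for n
    using dependent by metis
  then have rel: "(\<Sum>k<N. g k * a (n + k)) + g N * a (n + N) = 0" for n
    by (simp add: lessThan_Suc_atMost[symmetric])
  have gN: "g N \<noteq> 0" using N by (simp add: g_def)
  have "N \<noteq> 0"
    using rel[of 0] gN \<open>a 0 \<noteq> 0\<close> by (cases N) auto
  moreover have "a n = (\<Sum>i = 1..N. (- g (N - i) / g N) * a (n - i))" if "n \<ge> N" for n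
  proof -
    have "(\<Sum>i = 1..N. (- g (N - i) / g N) * a (n - i))
        = (\<Sum>k<N. (- g k / g N) * a (n - N + k))"
      using that by (intro sum.reindex_bij_witness[of _ "\<lambda>k. N - k" "\<lambda>i. N - i"]) auto
    also have "\<dots> = - (\<Sum>k<N. g k * a (n - N + k)) / g N"
      by (simp add: sum_divide_distrib sum_negf)
    also have "\<dots> = a n"
    proof -
      have "- (\<Sum>k<N. g k * a (n - N + k)) = g N * a n"
        using rel[of "n - N"] that by (simp add: eq_neg_iff_add_eq_0 neg_eq_iff_add_eq_0)
      then show ?thesis using gN by simp
    qed
    finally show ?thesis by simp
  qed
  ultimately show ?thesis
    by (intro exI[of _ N] conjI exI[of _ "\<lambda>i. - g (N - i) / g N"]) auto
qed

lemma solution_vanishes_if_initially_zero: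
  fixes b :: "nat \<Rightarrow> 'a::monoid_add"
  assumes "\<And>n. n \<ge> M \<Longrightarrow> b (Suc n) = b n + b (n - f n)"
    and "\<And>n. n \<le> M \<Longrightarrow> b n = 0"
  shows "b n = 0"
proof (induction n rule: less_induct)
  case (less n)
  show ?case
  proof (cases "n \<le> M")
    case True
    then show ?thesis using assms(2) by simp
  next
    case False
    then obtain m where "n = Suc m" "m \<ge> M" by (cases n) auto
    then show ?thesis using assms(1)[of m] less by simp
  qed
qed

lemma periodic_mult:
  fixes f :: "nat \<Rightarrow> 'a"
  assumes "\<And>n. f (n + p) = f n"
  shows "f (n + m * p) = f n"
proof (induction m)
  case (Suc m)
  have "f (n + Suc m * p) = f ((n + m * p) + p)" by (simp add: algebra_simps)
  then show ?case using assms Suc by simp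
qed simp

lemma periodic_bounded:
  fixes f :: "nat \<Rightarrow> nat"
  assumes "p \<ge> 1" "\<And>n. f (n + p) = f n"
  shows "\<exists>M. \<forall>n. f n \<le> M"
proof (intro exI allI)
  fix n
  have "f n = f (n mod p)"
    using periodic_mult[of f p "n mod p" "n div p"] assms(2) by simp
  then show "f n \<le> Max (f ` {..<p})"
    using assms(1) by simp
qed

text \<open>The bound \<open>f n \<le> n\<close> keeps the subtraction \<open>n - f n\<close> from being truncated; in the translated
  sequence there is more room below, so a truncation would give a different equation.\<close>

lemma f_recursion_translate:
  assumes "f (n + k) = f n" "f n \<le> n"
  shows "f_recursion f (Suc n + k) = f_recursion f (n + k) + f_recursion f (n - f n + k)"
  using assms by simp

theorem theorem1p5:
  fixes f :: "nat \<Rightarrow> nat"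
  assumes periodic: "\<exists>p\<ge>1. \<forall>n. f (n + p) = f n"
  shows "\<exists>k\<ge>1. \<exists>c :: nat \<Rightarrow> real. \<forall>n\<ge>k.
           real (f_sequence f n) = (\<Sum>i = 1..k. c i * real (f_sequence f (n - i)))"
proof -
  obtain p where p: "p \<ge> 1" "\<And>n. f (n + p) = f n" using periodic by blast
  obtain M where M: "\<And>n. f n \<le> M" using periodic_bounded[of p f] p by blast
  define a where "a n = real (f_recursion f n)" for n
  \<comment> \<open>The shifts: one more multiple of \<open>p\<close> than there are initial values.\<close>
  define K where "K = (\<lambda>m. m * p) ` {..Suc M}"
  have K: "finite K" "card {..M} < card K"
    using p(1) by (auto simp: K_def card_image inj_on_def)
  obtain c where c: "\<exists>k\<in>K. c k \<noteq> 0" "\<And>j. j \<le> M \<Longrightarrow> (\<Sum>k\<in>K. c k * a (j + k)) = 0"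
    using nontrivial_homogeneous_solution[of "{..M}" K "\<lambda>k j. a (j + k)"] K by auto
  have translate: "a (Suc n + k) = a (n + k) + a (n - f n + k)" if "n \<ge> M" "k \<in> K" for n k
  proof -
    have "f (n + k) = f n"
      using that(2) periodic_mult[of f p] p(2) by (auto simp: K_def)
    moreover have "f n \<le> n" using M[of n] that(1) by simp
    ultimately show ?thesis
      unfolding a_def f_recursion_translate[of f n k] by (simp add: f_recursion_translate)
  qed
  have "(\<Sum>k\<in>K. c k * a (n + k)) = 0" for n
  proof (rule solution_vanishes_if_initially_zero[where M = M and f = f])
    fix n assume "n \<ge> M"
    then show "(\<Sum>k\<in>K. c k * a (Suc n + k))
        = (\<Sum>k\<in>K. c k * a (n + k)) + (\<Sum>k\<in>K. c k * a (n - f n + k))"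
      using translate by (simp add: sum.distrib[symmetric] distrib_left del: add_Suc)
  qed (rule c(2))
  then show ?thesis
    using linear_recurrence_of_dependent_translates[of K c a] K(1) c(1)
    by (simp add: f_sequence_eq a_def)
qed

end
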